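(* Let $h,k\in\mathbb{S}^2$ be linearly independent (components of two reference vectors in the reference coordinate system) and let $a,b\in\mathbb{S}^2$ be the measured components of these two vectors, respectively, in the body-fixed coordinate system. Let $\check q=[q_0\; q^T]^T\in Q_a$ be any attitude estimate derived from the measurement $a$ of $h$ and $\check p=[p_0\; p^T]^T\in P_b$ any attitude estimate derived independently from the measurement $b$ of $k$. Put $$l_1=-q_0p_0-q^Tp,\qquad l_2=(-q_0p+p_0q-q\times p)^T(h\times k)-(q_0p_0+q^Tp)\,h^Tk,$$ $$l_3=k^T(q_0p-p_0q+q\times p),\qquad l_4=h^T(p_0q-q_0p+p\times q),$$ and define $\Phi_1,\Phi_2$ by $$\begin{bmatrix}\Phi_1-\Phi_2\\ \Phi_1+\Phi_2\end{bmatrix}=2\begin{bmatrix}\operatorname{atan2}(l_3-l_4,\,-(l_1+l_2))\\ \operatorname{atan2}(-(l_3+l_4),\,l_2-l_1)\end{bmatrix}.$$ Let $\check r_1=[c_1\; s_1h^T]^T$ and $\check r_2=[c_2\; s_2k^T]^T$ with $c_i=\cos(\Phi_i/2)$, $s_i=\sin(\Phi_i/2)$. Then the optimal estimate incorporating the measurement $b$ in $\check q$ is $\check r_1\otimes\check q$, and the optimal estimate incorporating the measurement $a$ in $\check p$ is $\check r_2\otimes\check p$; that is, the pair $(\Phi_1,\Phi_2)$ minimizes the displacement $\|\check r_1\otimes\check q-\check r_2\otimes\check p\|$ over all pairs of real rotation angles, so that $\check r_1\otimes\check q$ is an element of $Q_a$ closest to $P_b$ and $\check r_2\otimes\check p$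 is an element of $P_b$ closest to $Q_a$.
   Context: $\mathbb{S}^2$ and $\mathbb{S}^3$ are the unit spheres of $\mathbb{R}^3$ and $\mathbb{R}^4$, and $\|\cdot\|$ is the Euclidean norm. A quaternion is written $\check q=[q_0\; q^T]^T$ with scalar part $q_0\in\mathbb{R}$ and vector part $q\in\mathbb{R}^3$; the product is $\check q\otimes\check p=[\,q_0p_0-q^Tp,\; (q_0p+p_0q+q\times p)^T]^T$. An attitude quaternion is a unit quaternion (an element of $\mathbb{S}^3$). For $v\in\mathbb{R}^3$, $\check v=[0\; v^T]^T$. If a reference vector has components $h\in\mathbb{S}^2$ in the reference coordinate system and measured components $a\in\mathbb{S}^2$ in the body system, the feasibility cone of the measurement is the set of attitude quaternions consistent with it, $Q_a=\{\check q\in\mathbb{S}^3:\check q\otimes\check a=\check h\otimes\check q\}$; likewise $P_b=\{\check p\in\mathbb{S}^3:\check p\otimes\check b=\check k\otimes\check p\}$ is the feasibility cone of the measurement $b$ of $k$. Rotating $\check q\in Q_a$ through the angle $\Phi$ about $h$ means replacing it by $[\cos(\Phi/2)\; \sin(\Phi/2)h^T]^T\otimes\check q$. $\operatorname{atan2}(y,x)$ is the angle $\theta$ with $(x,y)=\sqrt{x^2+y^2}(\cos\theta,\sin\theta)$ (any value may be taken when $x=y=0$). "Closest" is with respect to the Euclidean distance in $\mathbb{R}^4$. *)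

theory Defs
  imports "HOL-Analysis.Analysis"
begin

text \<open>
  A quaternion is the pair of its scalar and vector parts. The product norm on
  \<^typ>\<open>real \<times> (real ^ 3)\<close> is \<open>sqrt (q0\<^sup>2 + (norm q)\<^sup>2)\<close>, so this is Euclidean 4-space and
  \<open>sphere 0 1\<close> in this type is the unit 3-sphere.
\<close>

type_synonym quat = "real \<times> (real ^ 3)"

fun qmult :: "quat \<Rightarrow> quat \<Rightarrow> quat"  (infixl "\<otimes>\<^sub>q" 70) where
  "(q0, q) \<otimes>\<^sub>q (p0, p) =
     (q0 * p0 - q \<bullet> p, q0 *\<^sub>R p + p0 *\<^sub>R q + cross3 q p)"

definition vec_quat :: "real ^ 3 \<Rightarrow> quat" where
  "vec_quat v = (0, v)"

text \<open>
  Attitude quaternions consistent with measuring, as \<open>a\<close> in body coordinates, the vector with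
  reference coordinates \<open>h\<close>.
\<close>

definition feasibility_cone :: "real ^ 3 \<Rightarrow> real ^ 3 \<Rightarrow> quat set" where
  "feasibility_cone h a = {q \<in> sphere 0 1. q \<otimes>\<^sub>q vec_quat a = vec_quat h \<otimes>\<^sub>q q}"

definition rot_quat :: "real ^ 3 \<Rightarrow> real \<Rightarrow> quat" where
  "rot_quat n \<Phi> = (cos (\<Phi> / 2), sin (\<Phi> / 2) *\<^sub>R n)"

text \<open>
  A relation rather than a function: no branch is chosen, and for \<open>x = y = 0\<close> every
  \<open>\<theta>\<close> qualifies.
\<close>

definition is_atan2 :: "real \<Rightarrow> real \<Rightarrow> real \<Rightarrow> bool" where
  "is_atan2 y x \<theta> \<longleftrightarrow>
     x = sqrt (x\<^sup>2 + y\<^sup>2) * cos \<theta> \<and> y = sqrt (x\<^sup>2 + y\<^sup>2) * sin \<theta>"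

definition closest_element :: "'a::metric_space set \<Rightarrow> 'a set \<Rightarrow> 'a \<Rightarrow> bool" where
  "closest_element A B x \<longleftrightarrow> is_arg_min (\<lambda>y. infdist y B) (\<lambda>y. y \<in> A) x"

end

theory Submission
  imports Defs
begin

text \<open>
  Left translation identifies the cone \<open>Q\<^sub>a\<close> with the circle of all rotations of \<open>q\<close> about \<open>h\<close>, since
  \<open>y \<otimes> q\<^sup>*\<close> commutes with \<open>h\<close> for \<open>y \<in> Q\<^sub>a\<close>; likewise for \<open>P\<^sub>b\<close>. So everything reduces to maximising
  the inner product of the two rotated quaternions. By bilinearity it is a combination of products of
  cosines and sines of the half angles with coefficients \<open>- l\<^sub>i\<close>, and in the half difference and the half
  sum of the two angles it separates into two independent terms \<open>x cos \<theta> + y sin \<theta>\<close>, each of which is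
  largest at \<open>\<theta> = atan2(y, x)\<close>.
\<close>

lemmas quat_components =
  qmult.simps prod.inject inner_Pair vec_eq_iff forall_3 cross3_def inner_vec_def sum_3 vector_3
  inner_real_def vector_add_component vector_minus_component vector_uminus_component
  vector_scaleR_component zero_index real_scaleR_def

text \<open>With \<open>quat_components\<close> both sides become polynomials in the real
  coordinates, and ring normalisation decides the equality.\<close>

lemma qmult_assoc: "(x \<otimes>\<^sub>q y) \<otimes>\<^sub>q z = x \<otimes>\<^sub>q (y \<otimes>\<^sub>q z)"
  by (cases x; cases y; cases z) (simp only: quat_components, simp add: algebra_simps)

definition qconj :: "quat \<Rightarrow> quat" where
  "qconj x = (fst x, - snd x)"

lemma qmult_qconj:
  "x \<otimes>\<^sub>q qconj x = ((norm x)\<^sup>2, 0)" "qconj x \<otimes>\<^sub>q x = ((norm x)\<^sup>2, 0)"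
  by (cases x; simp add: qconj_def norm_Pair dot_square_norm power2_eq_square cross_minus_right
      cross_minus_left)+

lemma qconj_qmult: "qconj (x \<otimes>\<^sub>q y) = qconj y \<otimes>\<^sub>q qconj x"
  by (cases x; cases y)
    (simp only: qconj_def fst_conv snd_conv quat_components, simp add: algebra_simps)

lemma norm_qconj: "norm (qconj x) = norm x"
  by (cases x) (simp add: qconj_def norm_Pair)

lemma qmult_scalar: "x \<otimes>\<^sub>q (c, 0) = c *\<^sub>R x" "(c *\<^sub>R x) \<otimes>\<^sub>q y = c *\<^sub>R (x \<otimes>\<^sub>q y)"
  by (cases x; cases y; simp add: cross_mult_left algebra_simps)+

lemma qmult_one: "(1, 0) \<otimes>\<^sub>q x = x" "x \<otimes>\<^sub>q (1, 0) = x"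
  by (cases x; simp)+

text \<open>Conjugation reverses products, so the inner factor
  \<open>y \<otimes>\<^sub>q qconj y\<close> is a scalar and can be pulled out.\<close>

lemma norm_qmult: "norm (x \<otimes>\<^sub>q y) = norm x * norm y"
proof -
  have "(x \<otimes>\<^sub>q y) \<otimes>\<^sub>q qconj (x \<otimes>\<^sub>q y) = x \<otimes>\<^sub>q (y \<otimes>\<^sub>q qconj y) \<otimes>\<^sub>q qconj x"
    by (simp only: qconj_qmult qmult_assoc)
  then have "(norm (x \<otimes>\<^sub>q y))\<^sup>2 = (norm x * norm y)\<^sup>2"
    by (simp add: qmult_qconj qmult_scalar power_mult_distrib mult.commute)
  then show ?thesis
    by (simp add: power2_eq_iff_nonneg)
qed

lemma norm_rot_quat: "norm n = 1 \<Longrightarrow> norm (rot_quat n \<phi>) = 1"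
  by (simp add: rot_quat_def norm_Pair)

lemma rot_quat_commute: "rot_quat n \<phi> \<otimes>\<^sub>q vec_quat n = vec_quat n \<otimes>\<^sub>q rot_quat n \<phi>"
  by (simp add: rot_quat_def vec_quat_def cross_mult_left cross_mult_right)

lemma rot_quat_qmult:
  "rot_quat n \<phi> \<otimes>\<^sub>q x = cos (\<phi> / 2) *\<^sub>R x + sin (\<phi> / 2) *\<^sub>R (vec_quat n \<otimes>\<^sub>q x)"
  by (cases x) (simp add: rot_quat_def vec_quat_def cross_mult_left algebra_simps)

text \<open>The rotation commutes with its axis, so it passes through \<open>vec_quat h\<close> in
  the cone equation.\<close>

lemma rot_quat_qmult_in_feasibility_cone:
  assumes "norm h = 1" "q \<in> feasibility_cone h a"
  shows "rot_quat h \<phi> \<otimes>\<^sub>q q \<in> feasibility_cone h a"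
  using assms norm_rot_quat[OF assms(1)] rot_quat_commute[of h \<phi>]
  by (simp add: feasibility_cone_def norm_qmult) (metis qmult_assoc)

text \<open>Commuting with \<open>h\<close> kills the cross product, so the vector part of
  \<open>u\<close> is parallel to \<open>h\<close>; unit norm then puts \<open>u\<close> on a
  circle.\<close>

lemma commutes_with_axis_imp_rot_quat:
  assumes h: "norm h = 1" and u: "norm u = 1"
    and comm: "u \<otimes>\<^sub>q vec_quat h = vec_quat h \<otimes>\<^sub>q u"
  obtains \<phi> where "u = rot_quat h \<phi>"
proof -
  obtain c v where uv: "u = (c, v)" by (cases u)
  have "cross3 v h = cross3 h v"
    using comm by (simp add: uv vec_quat_def)
  then have "cross3 h v = 0"
    using cross_skew[of v h] by (simp add: vec_eq_iff)
  then have "cross3 h (cross3 h v) = 0"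
    by simp
  moreover have "h \<bullet> h = 1"
    using h by (simp add: norm_eq_1)
  \<comment> \<open>Lagrange's formula gives \<open>(h \<bullet> v) *\<^sub>R h - v\<close> for the
    vanishing double cross product.\<close>
  ultimately have v: "v = (h \<bullet> v) *\<^sub>R h"
    using Lagrange[of h h v] by simp
  have "c\<^sup>2 + (norm v)\<^sup>2 = 1"
    using u by (simp add: uv norm_Pair)
  moreover have "(norm v)\<^sup>2 = (h \<bullet> v)\<^sup>2"
    by (subst v) (simp add: h)
  ultimately obtain t where "c = cos t" "h \<bullet> v = sin t"
    using sincos_total_2pi[of c "h \<bullet> v"] by metis
  then have "u = rot_quat h (2 * t)"
    using v by (simp add: uv rot_quat_def)
  then show ?thesis ..
qed

lemma feasibility_cone_rot_quat:
  assumes h: "norm h = 1" and q: "q \<in> feasibility_cone h a" and y: "y \<in> feasibility_cone h a"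
  obtains \<phi> where "y = rot_quat h \<phi> \<otimes>\<^sub>q q"
proof -
  have nq: "norm q = 1" and ny: "norm y = 1"
    and qa: "q \<otimes>\<^sub>q vec_quat a = vec_quat h \<otimes>\<^sub>q q" and ya: "y \<otimes>\<^sub>q vec_quat a = vec_quat h \<otimes>\<^sub>q y"
    using q y by (simp_all add: feasibility_cone_def)
  have inv: "q \<otimes>\<^sub>q qconj q = (1, 0)" "qconj q \<otimes>\<^sub>q q = (1, 0)"
    using nq by (simp_all add: qmult_qconj)
  \<comment> \<open>The cone equation of \<open>q\<close>, multiplied by \<open>qconj q\<close> on
    both sides: \<open>vec_quat h\<close> moves past \<open>qconj q\<close> as
    \<open>vec_quat a\<close>, and then past \<open>y\<close> as \<open>vec_quat h\<close>
    again.\<close>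
  have "qconj q \<otimes>\<^sub>q vec_quat h = qconj q \<otimes>\<^sub>q (vec_quat h \<otimes>\<^sub>q q) \<otimes>\<^sub>q qconj q"
    by (simp only: qmult_assoc inv qmult_one)
  also have "\<dots> = (qconj q \<otimes>\<^sub>q q) \<otimes>\<^sub>q vec_quat a \<otimes>\<^sub>q qconj q"
    by (simp only: qmult_assoc qa[symmetric])
  also have "\<dots> = vec_quat a \<otimes>\<^sub>q qconj q"
    by (simp only: inv qmult_one)
  finally have "(y \<otimes>\<^sub>q qconj q) \<otimes>\<^sub>q vec_quat h = vec_quat h \<otimes>\<^sub>q (y \<otimes>\<^sub>q qconj q)"
    by (metis qmult_assoc ya)
  moreover have "norm (y \<otimes>\<^sub>q qconj q) = 1"
    by (simp add: norm_qmult norm_qconj nq ny)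
  ultimately obtain \<phi> where "y \<otimes>\<^sub>q qconj q = rot_quat h \<phi>"
    using commutes_with_axis_imp_rot_quat h by blast
  then have "y = rot_quat h \<phi> \<otimes>\<^sub>q q"
    by (metis inv(2) qmult_assoc qmult_one(2))
  then show ?thesis ..
qed

text \<open>Each rotated quaternion is a cosine-sine combination of two fixed ones, whose four
  mutual inner products are the \<open>- l\<^sub>i\<close>. The factor 2 comes from the
  product-to-sum formulas.\<close>

lemma inner_rot_quat_qmult:
  fixes h k q p :: "real ^ 3" and q0 p0 :: real
  defines "l1 \<equiv> - q0 * p0 - q \<bullet> p"
    and "l2 \<equiv> (- q0 *\<^sub>R p + p0 *\<^sub>R q - cross3 q p) \<bullet> cross3 h k
              - (q0 * p0 + q \<bullet> p) * (h \<bullet> k)"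
    and "l3 \<equiv> k \<bullet> (q0 *\<^sub>R p - p0 *\<^sub>R q + cross3 q p)"
    and "l4 \<equiv> h \<bullet> (p0 *\<^sub>R q - q0 *\<^sub>R p + cross3 p q)"
  shows "2 * ((rot_quat h \<phi>1 \<otimes>\<^sub>q (q0, q)) \<bullet> (rot_quat k \<phi>2 \<otimes>\<^sub>q (p0, p))) =
      (- (l1 + l2) * cos ((\<phi>1 - \<phi>2) / 2) + (l3 - l4) * sin ((\<phi>1 - \<phi>2) / 2))
      + ((l2 - l1) * cos ((\<phi>1 + \<phi>2) / 2) + (- (l3 + l4)) * sin ((\<phi>1 + \<phi>2) / 2))"
proof -
  have 1: "(q0, q) \<bullet> (p0, p) = - l1"
    by (simp add: l1_def)
  have 2: "(vec_quat h \<otimes>\<^sub>q (q0, q)) \<bullet> (vec_quat k \<otimes>\<^sub>q (p0, p)) = - l2"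
    by (simp only: l2_def vec_quat_def quat_components, simp add: algebra_simps)
  have 3: "(q0, q) \<bullet> (vec_quat k \<otimes>\<^sub>q (p0, p)) = - l3"
    by (simp only: l3_def vec_quat_def quat_components, simp add: algebra_simps)
  have 4: "(vec_quat h \<otimes>\<^sub>q (q0, q)) \<bullet> (p0, p) = - l4"
    by (simp only: l4_def vec_quat_def quat_components, simp add: algebra_simps)
  show ?thesis
    unfolding rot_quat_qmult inner_add_left inner_add_right inner_scaleR_left inner_scaleR_right
      1 2 3 4 diff_divide_distrib add_divide_distrib cos_add cos_diff sin_add sin_diff
    by (simp add: algebra_simps)
qed

text \<open>In polar form the left side is \<open>r * cos (\<theta> - \<psi>)\<close>, bounded by
  \<open>r\<close>, which is attained at \<open>\<theta>\<close>. This covers \<open>r = 0\<close>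
  too.\<close>

lemma is_atan2_maximizes:
  assumes "is_atan2 y x \<theta>"
  shows "x * cos \<psi> + y * sin \<psi> \<le> x * cos \<theta> + y * sin \<theta>"
proof -
  define r where "r = sqrt (x\<^sup>2 + y\<^sup>2)"
  have xy: "x = r * cos \<theta>" "y = r * sin \<theta>"
    using assms unfolding is_atan2_def r_def by auto
  have "x * cos \<psi> + y * sin \<psi> = r * cos (\<theta> - \<psi>)"
    by (simp add: xy cos_diff algebra_simps)
  also have "\<dots> \<le> r"
    by (simp add: r_def mult_left_le)
  also have "r = r * ((cos \<theta>)\<^sup>2 + (sin \<theta>)\<^sup>2)"
    by simp
  also have "\<dots> = x * cos \<theta> + y * sin \<theta>"
    unfolding xy by (simp only: distrib_left power2_eq_square mult.assoc)
  finally show ?thesis .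
qed

lemma closest_elementI:
  assumes "x \<in> A" "z \<in> B" "\<And>x' z'. x' \<in> A \<Longrightarrow> z' \<in> B \<Longrightarrow> dist x z \<le> dist x' z'"
  shows "closest_element A B x"
proof -
  have "infdist x B \<le> infdist y B" if "y \<in> A" for y
  proof -
    have "infdist x B \<le> dist x z"
      using assms(2) by (rule infdist_le)
    \<comment> \<open>\<open>z\<close> witnesses that \<open>B\<close> is nonempty, so
      \<open>infdist y B\<close> is a genuine infimum and not the default 0.\<close>
    also have "\<dots> \<le> infdist y B"
      unfolding infdist_def using assms(2,3) that by (auto intro!: cINF_greatest)
    finally show ?thesis .
  qed
  then show ?thesis
    using assms(1) by (auto simp: closest_element_def is_arg_min_def not_less)
qed

theorem theorem7:
  fixes h k a b q p :: "real ^ 3"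
    and q0 p0 l1 l2 l3 l4 \<theta>1 \<theta>2 \<Phi>1 \<Phi>2 :: real
  assumes "h \<in> sphere 0 1" and "k \<in> sphere 0 1"
    and "h \<noteq> k" and "independent {h, k}"
    and "a \<in> sphere 0 1" and "b \<in> sphere 0 1"
    and "(q0, q) \<in> feasibility_cone h a"
    and "(p0, p) \<in> feasibility_cone k b"
    and "l1 = - q0 * p0 - q \<bullet> p"
    and "l2 = (- q0 *\<^sub>R p + p0 *\<^sub>R q - cross3 q p) \<bullet> cross3 h k
              - (q0 * p0 + q \<bullet> p) * (h \<bullet> k)"
    and "l3 = k \<bullet> (q0 *\<^sub>R p - p0 *\<^sub>R q + cross3 q p)"
    and "l4 = h \<bullet> (p0 *\<^sub>R q - q0 *\<^sub>R p + cross3 p q)"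
    and "is_atan2 (l3 - l4) (- (l1 + l2)) \<theta>1"
    and "is_atan2 (- (l3 + l4)) (l2 - l1) \<theta>2"
    and "\<Phi>1 - \<Phi>2 = 2 * \<theta>1"
    and "\<Phi>1 + \<Phi>2 = 2 * \<theta>2"
  shows "(\<forall>\<phi>1 \<phi>2. norm (rot_quat h \<Phi>1 \<otimes>\<^sub>q (q0, q) - rot_quat k \<Phi>2 \<otimes>\<^sub>q (p0, p))
                  \<le> norm (rot_quat h \<phi>1 \<otimes>\<^sub>q (q0, q) - rot_quat k \<phi>2 \<otimes>\<^sub>q (p0, p)))
       \<and> closest_element (feasibility_cone h a) (feasibility_cone k b)
           (rot_quat h \<Phi>1 \<otimes>\<^sub>q (q0, q))
       \<and> closest_element (feasibility_cone k b) (feasibility_cone h a)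
           (rot_quat k \<Phi>2 \<otimes>\<^sub>q (p0, p))"
proof -
  let ?r = "\<lambda>\<phi>. rot_quat h \<phi> \<otimes>\<^sub>q (q0, q)" and ?s = "\<lambda>\<phi>. rot_quat k \<phi> \<otimes>\<^sub>q (p0, p)"
  note q = assms(7) and p = assms(8)
  have h: "norm h = 1" and k: "norm k = 1"
    using assms(1,2) by simp_all
  have unit: "norm (?r \<phi>) = 1" "norm (?s \<phi>) = 1" for \<phi>
    using q p h k by (simp_all add: norm_qmult norm_rot_quat feasibility_cone_def del: qmult.simps)
  have half: "(\<Phi>1 - \<Phi>2) / 2 = \<theta>1" "(\<Phi>1 + \<Phi>2) / 2 = \<theta>2"
    using assms(15,16) by simp_all
  have opt: "norm (?r \<Phi>1 - ?s \<Phi>2) \<le> norm (?r \<phi>1 - ?s \<phi>2)" for \<phi>1 \<phi>2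
  proof -
    \<comment> \<open>Both summands are maximal at once, as half difference and half sum of the
      optimal angles are \<open>\<theta>1\<close> and \<open>\<theta>2\<close>.\<close>
    have "2 * (?r \<phi>1 \<bullet> ?s \<phi>2) \<le> 2 * (?r \<Phi>1 \<bullet> ?s \<Phi>2)"
      unfolding inner_rot_quat_qmult half assms(9-12)[symmetric]
      by (rule add_mono[OF is_atan2_maximizes[OF assms(13)] is_atan2_maximizes[OF assms(14)]])
    \<comment> \<open>Both quaternions are unit, so the distance decreases exactly as the inner
      product grows.\<close>
    moreover have "(norm (?r \<phi> - ?s \<psi>))\<^sup>2 = 2 - 2 * (?r \<phi> \<bullet> ?s \<psi>)" for \<phi> \<psi>
      unfolding power2_norm_eq_inner inner_diff_left inner_diff_right
      using unit[of \<phi>] unit[of \<psi>] by (simp add: norm_eq_1 inner_commute del: qmult.simps)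
    ultimately have "(norm (?r \<Phi>1 - ?s \<Phi>2))\<^sup>2 \<le> (norm (?r \<phi>1 - ?s \<phi>2))\<^sup>2"
      by simp
    then show ?thesis
      by (rule power2_le_imp_le) simp
  qed
  \<comment> \<open>Any two elements of the cones are rotations of the given estimates, so
    optimality over angles is optimality over the cones.\<close>
  have dist: "dist (?r \<Phi>1) (?s \<Phi>2) \<le> dist x z"
    if "x \<in> feasibility_cone h a" "z \<in> feasibility_cone k b" for x z
    using feasibility_cone_rot_quat[OF h q that(1)] feasibility_cone_rot_quat[OF k p that(2)] opt
    by (metis dist_norm)
  note mem = rot_quat_qmult_in_feasibility_cone[OF h q, of \<Phi>1]
    rot_quat_qmult_in_feasibility_cone[OF k p, of \<Phi>2]
  have "closest_element (feasibility_cone h a) (feasibility_cone k b) (?r \<Phi>1)"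
    using mem dist by (rule closest_elementI)
  moreover have "closest_element (feasibility_cone k b) (feasibility_cone h a) (?s \<Phi>2)"
    using mem(2,1) by (rule closest_elementI) (metis dist dist_commute)
  ultimately show ?thesis
    using opt by blast
qed

end
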